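(* Let $k\ge 1$ and let $\mathbb{F}$ be an algebraically closed field whose characteristic is $0$ or at least $k+1$. Let $f\in(\mathbb{F}^d)^{\otimes k}$ and $g\in(\mathbb{F}^e)^{\otimes k}$ be symmetric tensors. Then $f\lesssim g$ if and only if $f\lesssim_{\mathrm{s}} g$.
   Context: A tensor $f\in(\mathbb{F}^d)^{\otimes k}$ is symmetric if its coordinates are invariant under all permutations of the $k$ indices. For tensors $f\in(\mathbb{F}^d)^{\otimes k}$, $g\in(\mathbb{F}^e)^{\otimes k}$: write $f\le g$ (restriction) if there are linear maps $A^{(1)},\dots,A^{(k)}:\mathbb{F}^e\to\mathbb{F}^d$ with $f=(A^{(1)}\otimes\cdots\otimes A^{(k)})g$; write $f\le_{\mathrm{s}} g$ (symmetric restriction) if there is a single linear map $A:\mathbb{F}^e\to\mathbb{F}^d$ with $f=A^{\otimes k}g$. The power $f^{\otimes n}$ is regarded as a $k$-tensor in $((\mathbb{F}^d)^{\otimes n})^{\otimes k}$ (grouping corresponding legs). Write $f\lesssim g$ (asymptotic restriction) if $f^{\otimes n}\le g^{\otimes (n+o(n))}$, meaning there is a sequence of nonnegative integers $a_n$ with $a_n/n\to 0$ such that $f^{\otimes n}\le g^{\otimes(n+a_n)}$ for all $n\ge1$. Write $f\lesssim_{\mathrm{s}} g$ (asymptotic symmetric restriction) if, in the same sense, $f^{\otimes n}\le_{\mathrm{s}} g^{\otimes (n+o(n))}$. *)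

theory Defs
  imports
    Complex_Main
    "HOL-Computational_Algebra.Computational_Algebra"
    "HOL-Combinatorics.Combinatorics"
begin

definition multi_index :: "nat \<Rightarrow> 'i set \<Rightarrow> 'i list set"
  where "multi_index k I = {xs. set xs \<subseteq> I \<and> length xs = k}"

text \<open>
  For a finite set I, an element of the k-fold tensor power of F^I is given by its coordinates
  with respect to the standard basis: a function on \<^term>\<open>multi_index k I\<close>, whose values
  outside this set are irrelevant. The space F^d is the case I = \<^term>\<open>{..<d::nat}\<close>, and
  the n-fold tensor power of F^d is the coordinate space over I = \<^term>\<open>multi_index n {..<d::nat}\<close>.
\<close>

type_synonym ('i, 'a) tensor = "'i list \<Rightarrow> 'a"

definition symmetric_tensor :: "nat \<Rightarrow> 'i set \<Rightarrow> ('i, 'a) tensor \<Rightarrow> bool"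
  where "symmetric_tensor k I f \<longleftrightarrow>
    (\<forall>\<pi>. \<pi> permutes {..<k} \<longrightarrow> (\<forall>xs \<in> multi_index k I. f (permute_list \<pi> xs) = f xs))"

text \<open>
  A linear map from F^J to F^I is given by its matrix, with entry \<open>M i j\<close> in row \<open>i \<in> I\<close> and
  column \<open>j \<in> J\<close>. The following are the coordinates of the image of \<open>g\<close> under the tensor
  product of the linear maps \<open>A 0, \<dots>, A (k - 1)\<close>.
\<close>

definition apply_tensor_maps ::
  "nat \<Rightarrow> 'j set \<Rightarrow> (nat \<Rightarrow> 'i \<Rightarrow> 'j \<Rightarrow> 'a::field) \<Rightarrow> ('j, 'a) tensor \<Rightarrow> ('i, 'a) tensor"
  where "apply_tensor_maps k J A g =
    (\<lambda>xs. \<Sum>ys \<in> multi_index k J. (\<Prod>l<k. A l (xs ! l) (ys ! l)) * g ys)"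

definition restricts ::
  "nat \<Rightarrow> 'i set \<Rightarrow> ('i, 'a::field) tensor \<Rightarrow> 'j set \<Rightarrow> ('j, 'a) tensor \<Rightarrow> bool"
  where "restricts k I f J g \<longleftrightarrow>
    (\<exists>A. \<forall>xs \<in> multi_index k I. f xs = apply_tensor_maps k J A g xs)"

definition sym_restricts ::
  "nat \<Rightarrow> 'i set \<Rightarrow> ('i, 'a::field) tensor \<Rightarrow> 'j set \<Rightarrow> ('j, 'a) tensor \<Rightarrow> bool"
  where "sym_restricts k I f J g \<longleftrightarrow>
    (\<exists>A. \<forall>xs \<in> multi_index k I. f xs = apply_tensor_maps k J (\<lambda>_. A) g xs)"

text \<open>
  In the n-th tensor power, corresponding legs are grouped: each of the k indices in \<open>xs\<close> is
  itself a list of length \<open>n\<close>, whose entry \<open>m\<close> indexes the corresponding leg of the m-th factor.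
\<close>

definition tensor_power :: "nat \<Rightarrow> ('i, 'a::field) tensor \<Rightarrow> ('i list, 'a) tensor"
  where "tensor_power n f = (\<lambda>xs. \<Prod>m<n. f (map (\<lambda>x. x ! m) xs))"

definition asymp_restricts ::
  "nat \<Rightarrow> 'i set \<Rightarrow> ('i, 'a::field) tensor \<Rightarrow> 'j set \<Rightarrow> ('j, 'a) tensor \<Rightarrow> bool"
  where "asymp_restricts k I f J g \<longleftrightarrow>
    (\<exists>a :: nat \<Rightarrow> nat. (\<lambda>n. real (a n) / real n) \<longlonglongrightarrow> 0 \<and>
      (\<forall>n\<ge>1. restricts k (multi_index n I) (tensor_power n f)
                  (multi_index (n + a n) J) (tensor_power (n + a n) g)))"

definition asymp_sym_restricts ::
  "nat \<Rightarrow> 'i set \<Rightarrow> ('i, 'a::field) tensor \<Rightarrow> 'j set \<Rightarrow> ('j, 'a) tensor \<Rightarrow> bool"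
  where "asymp_sym_restricts k I f J g \<longleftrightarrow>
    (\<exists>a :: nat \<Rightarrow> nat. (\<lambda>n. real (a n) / real n) \<longlonglongrightarrow> 0 \<and>
      (\<forall>n\<ge>1. sym_restricts k (multi_index n I) (tensor_power n f)
                  (multi_index (n + a n) J) (tensor_power (n + a n) g)))"

end

theory Submission
  imports Defs
begin

text \<open>
  Symmetrizing a restriction \<open>(A\<^sub>1 \<otimes> \<dots> \<otimes> A\<^sub>k) h = f\<close> over all permutations of the maps leaves \<open>f\<close>
  unchanged up to the invertible factor \<open>k!\<close>, and the symmetrized operator is a symmetric restriction
  of \<open>h\<close> times the symmetric tensor of the monomial \<open>x\<^sub>1 \<cdots> x\<^sub>k\<close>. So it suffices that some fixed power
  of \<open>g\<close> restricts symmetrically to this monomial; the extra power is absorbed in the \<open>o(n)\<close>.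

  Regard \<open>g\<close> as a form of degree \<open>k\<close>. If it is not a power of a linear form, then it has a zero \<open>w0\<close>
  and a vector \<open>w1\<close> such that, for some \<open>0 < a < k\<close>, the contraction of \<open>g\<close> with \<open>b\<close> copies of
  \<open>w1\<close> and \<open>k - b\<close> copies of \<open>w0\<close> vanishes for \<open>b < a\<close> but not for \<open>b = a\<close>. This yields the
  monomial in the power of \<open>g\<close> with exponent \<open>k choose a\<close>. If \<open>g\<close> is a power of a linear form, then
  any restriction of one of its powers has rank at most one, and a symmetric tensor of rank at most
  one is a symmetric restriction already.
\<close>

subsection \<open>Symmetric multilinear forms\<close>

text \<open>If \<open>p\<close> were nonconstant, \<open>p + 1\<close> would have a root, and
  \<open>p\<close> would take the value -1 there. This justifies comparing coefficients in a
  parameter \<open>t\<close>.\<close>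

lemma vanishing_poly:
  fixes f :: "nat \<Rightarrow> 'a::alg_closed_field"
  assumes "\<And>t. (\<Sum>b\<le>m. f b * t ^ b) = 0" and "b \<le> m"
  shows "f b = 0"
proof -
  define p where "p = (\<Sum>b\<le>m. monom (f b) b)"
  have p0: "poly p t = 0" for t
    using assms(1) by (simp add: p_def poly_sum poly_monom)
  have "p = 0"
  proof (cases "degree p > 0")
    case True
    then have "degree (p + 1) > 0" by (simp add: degree_add_eq_left)
    then obtain x where "poly (p + 1) x = 0" using alg_closed_imp_poly_has_root by blast
    then show ?thesis using p0 by simp
  next
    case False
    then obtain c where "p = [:c:]" by (metis degree_eq_zeroE gr0I)
    then show ?thesis using p0[of 0] by simp
  qed
  then have "coeff p b = 0" by simp
  then show ?thesis using assms(2) by (simp add: p_def coeff_sum)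
qed

text \<open>The \<open>k\<close> arguments form one list. Linearity is demanded in the first slot
  only, since \<open>H_perm\<close> carries it to the others.\<close>

locale symmetric_form =
  fixes k :: nat and H :: "('i \<Rightarrow> 'a::alg_closed_field) list \<Rightarrow> 'a"
  assumes H_perm: "\<lbrakk>length us = k; mset us = mset vs\<rbrakk> \<Longrightarrow> H us = H vs"
    and H_linear: "Suc (length vs) = k \<Longrightarrow> H ((\<lambda>i. u i + t * v i) # vs) = H (u # vs) + t * H (v # vs)"
    and k_pos: "k \<ge> 1"
    and char: "CHAR('a) = 0 \<or> CHAR('a) \<ge> k + 1"
begin

text \<open>One copy of the sum is expanded by linearity, the resulting \<open>u\<close> or
  \<open>v\<close> joins the fixed tail \<open>vs\<close>, and Pascal's rule combines the two
  sums.\<close>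

lemma binomial_expansion:
  assumes "m + length vs = k"
  shows "H (replicate m (\<lambda>i. u i + t * v i) @ vs) =
    (\<Sum>b\<le>m. of_nat (m choose b) * H (replicate b v @ replicate (m - b) u @ vs) * t ^ b)"
  using assms
proof (induction m arbitrary: vs)
  case (Suc m)
  let ?w = "\<lambda>i. u i + t * v i"
  define T where "T b = H (replicate b v @ replicate (Suc m - b) u @ vs)" for b
  have "H (replicate (Suc m) ?w @ vs) =
      H (u # replicate m ?w @ vs) + t * H (v # replicate m ?w @ vs)"
    using H_linear[of "replicate m ?w @ vs" u t v] Suc.prems by simp
  also have "H (u # replicate m ?w @ vs) = H (replicate m ?w @ u # vs)"
    by (rule H_perm) (use Suc.prems in auto)
  also have "\<dots> = (\<Sum>b\<le>m. of_nat (m choose b) * T b * t ^ b)"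
  proof (subst Suc.IH)
    have "H (replicate b v @ replicate (m - b) u @ u # vs) = T b" if "b \<le> m" for b
      unfolding T_def by (rule H_perm) (use Suc.prems that in \<open>auto simp: Suc_diff_le\<close>)
    then show "(\<Sum>b\<le>m. of_nat (m choose b) * H (replicate b v @ replicate (m - b) u @ u # vs) * t ^ b)
        = (\<Sum>b\<le>m. of_nat (m choose b) * T b * t ^ b)" by simp
  qed (use Suc.prems in auto)
  also have "H (v # replicate m ?w @ vs) = H (replicate m ?w @ v # vs)"
    by (rule H_perm) (use Suc.prems in auto)
  also have "\<dots> = (\<Sum>b\<le>m. of_nat (m choose b) * T (Suc b) * t ^ b)"
  proof (subst Suc.IH)
    have "H (replicate b v @ replicate (m - b) u @ v # vs) = T (Suc b)" if "b \<le> m" for b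
      unfolding T_def by (rule H_perm) (use Suc.prems that in \<open>auto\<close>)
    then show "(\<Sum>b\<le>m. of_nat (m choose b) * H (replicate b v @ replicate (m - b) u @ v # vs) * t ^ b)
        = (\<Sum>b\<le>m. of_nat (m choose b) * T (Suc b) * t ^ b)" by simp
  qed (use Suc.prems in auto)
  also have "(\<Sum>b\<le>m. of_nat (m choose b) * T b * t ^ b) +
      t * (\<Sum>b\<le>m. of_nat (m choose b) * T (Suc b) * t ^ b) =
      (\<Sum>b\<le>Suc m. of_nat (Suc m choose b) * T b * t ^ b)"
  proof -
    have "(\<Sum>b\<le>m. of_nat (m choose b) * T b * t ^ b) =
        (\<Sum>b\<le>Suc m. of_nat (m choose b) * T b * t ^ b)"
      by (simp add: binomial_eq_0)
    also have "\<dots> = T 0 + (\<Sum>b\<le>m. of_nat (m choose Suc b) * T (Suc b) * t ^ Suc b)"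
      by (subst sum.atMost_Suc_shift) simp
    finally show ?thesis
      by (subst sum.atMost_Suc_shift)
        (simp add: sum_distrib_left sum.distrib algebra_simps)
  qed
  finally show ?case by (simp only: T_def)
qed simp

text \<open>The condition on the characteristic acts through this fact: polarization can divide by
  multiplicities, and \<open>fact k\<close> is invertible.\<close>

lemma of_nat_neq_0: "0 < m \<Longrightarrow> m \<le> k \<Longrightarrow> of_nat m \<noteq> (0::'a)"
  using char by (auto simp: of_nat_eq_0_iff_char_dvd dest: dvd_imp_le)

text \<open>The vectors of \<open>vs\<close> enter one at a time. Adding \<open>t\<close> times
  \<open>v\<close> to the repeated vector gives a polynomial in \<open>t\<close> that vanishes
  identically; its linear coefficient is \<open>Suc m\<close> times the form with one
  \<open>u\<close> turned into \<open>v\<close>.\<close>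

lemma polarization:
  assumes "\<And>u. H (replicate (m + length vs) u @ ws) = 0"
    and "m + length vs + length ws = k"
  shows "H (replicate m u @ vs @ ws) = 0"
  using assms
proof (induction vs arbitrary: m u)
  case (Cons v vs)
  have "H (replicate (Suc m) (\<lambda>i. u i + t * v i) @ vs @ ws) = 0" for t
    by (rule Cons.IH) (use Cons.prems in auto)
  then have "(\<Sum>b\<le>Suc m. of_nat (Suc m choose b) *
      H (replicate b v @ replicate (Suc m - b) u @ vs @ ws) * t ^ b) = 0" for t
    using Cons.prems binomial_expansion[of "Suc m" "vs @ ws" u t v] by simp
  from vanishing_poly[of "\<lambda>b. of_nat (Suc m choose b) *
      H (replicate b v @ replicate (Suc m - b) u @ vs @ ws)", OF this, of 1]
  have "of_nat (Suc m) * H (v # replicate m u @ vs @ ws) = 0" by simp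
  then have "H (v # replicate m u @ vs @ ws) = 0"
    using Cons.prems of_nat_neq_0[of "Suc m"] by auto
  moreover have "H (v # replicate m u @ vs @ ws) = H (replicate m u @ (v # vs) @ ws)"
    by (rule H_perm) (use Cons.prems in auto)
  ultimately show ?case by simp
qed simp

text \<open>
  Unless some zero of the diagonal polynomial gives the second alternative, contracting with any
  zero annihilates the form; every vector is a zero plus a multiple of one fixed vector \<open>v\<close>.
\<close>

lemma rank_one_or_simple_degeneration:
  "(\<exists>\<tau>. \<forall>us. length us = k \<longrightarrow> H us = (\<Prod>u\<leftarrow>us. \<tau> u)) \<or>
    (\<exists>w0 w1 a. 1 \<le> a \<and> a < k \<and> H (replicate a w1 @ replicate (k - a) w0) \<noteq> 0 \<and>
      (\<forall>b<a. H (replicate b w1 @ replicate (k - b) w0) = 0))"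
proof (rule disjCI)
  assume no: "\<not> (\<exists>w0 w1 a. 1 \<le> a \<and> a < k \<and> H (replicate a w1 @ replicate (k - a) w0) \<noteq> 0 \<and>
      (\<forall>b<a. H (replicate b w1 @ replicate (k - b) w0) = 0))"
  \<comment> \<open>Otherwise the least \<open>b\<close> with nonzero contraction would give an
    excluded degeneration: it is at most \<open>k - 1\<close>, and it is not 0 because
    \<open>w0\<close> is a zero.\<close>
  have zero1: "H (replicate (k - 1) w1 @ [w0]) = 0" if z: "H (replicate k w0) = 0" for w0 w1
  proof (rule ccontr)
    let ?P = "\<lambda>b. H (replicate b w1 @ replicate (k - b) w0) \<noteq> 0"
    define a where "a = (LEAST b. ?P b)"
    assume "H (replicate (k - 1) w1 @ [w0]) \<noteq> 0"
    then have "?P (k - 1)" using k_pos by simp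
    then have "?P a" "a \<le> k - 1" and "\<forall>b<a. \<not> ?P b"
      unfolding a_def using LeastI[of ?P] Least_le[of ?P] not_less_Least[of _ ?P] by blast+
    moreover have "a \<noteq> 0" using z \<open>?P a\<close> by (intro notI) simp
    ultimately have "1 \<le> a \<and> a < k \<and> ?P a \<and> (\<forall>b<a. \<not> ?P b)" using k_pos by auto
    then show False using no by blast
  qed
  have zero2: "H (w0 # vs) = 0" if z: "H (replicate k w0) = 0" and len: "Suc (length vs) = k" for w0 vs
  proof -
    have "H (vs @ [w0]) = 0"
      using polarization[of 0 vs "[w0]"] zero1[OF z] len by auto
    also have "H (vs @ [w0]) = H (w0 # vs)" by (rule H_perm) (use len in auto)
    finally show ?thesis .
  qed
  show "\<exists>\<tau>. \<forall>us. length us = k \<longrightarrow> H us = (\<Prod>u\<leftarrow>us. \<tau> u)"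
  proof (cases "\<forall>w. H (replicate k w) = 0")
    case True
    have "H us = (\<Prod>u\<leftarrow>us. 0)" if "length us = k" for us
      using that k_pos True zero2 by (cases us) auto
    then show ?thesis by metis
  next
    case False
    then obtain v where v: "H (replicate k v) \<noteq> 0" by blast
    \<comment> \<open>This is a polynomial of degree \<open>k\<close> in \<open>t\<close> whose
      leading coefficient \<open>H (replicate k v)\<close> is nonzero.\<close>
    have "\<exists>t. H (replicate k (\<lambda>i. u i + t * v i)) = 0" for u
      using binomial_expansion[of k "[]" u _ v] v k_pos
        alg_closed[of k "\<lambda>b. of_nat (k choose b) * H (replicate b v @ replicate (k - b) u)"]
      by auto
    then obtain \<tau> where \<tau>: "\<And>u. H (replicate k (\<lambda>i. u i + \<tau> u * v i)) = 0" by metis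
    \<comment> \<open>The root spreads the constant \<open>H (replicate k v)\<close> evenly over the
      \<open>k\<close> factors.\<close>
    obtain \<kappa> where \<kappa>: "\<kappa> ^ k = H (replicate k v)"
      using nth_root_exists[of k "H (replicate k v)"] k_pos by auto
    \<comment> \<open>By \<open>zero2\<close>, contracting with the zero built from \<open>u\<close>
      gives 0, so each \<open>u\<close> can be traded for \<open>- \<tau> u\<close> times
      \<open>v\<close>.\<close>
    have *: "H (us @ replicate m v) = (\<Prod>u\<leftarrow>us. - \<tau> u) * H (replicate k v)"
      if "length us + m = k" for us m
      using that
    proof (induction us arbitrary: m)
      case (Cons u us)
      have "H ((\<lambda>i. u i + \<tau> u * v i) # us @ replicate m v) = 0"
        using Cons.prems by (intro zero2 \<tau>) auto
      then have "H (u # us @ replicate m v) = - \<tau> u * H (v # us @ replicate m v)"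
        using H_linear[of "us @ replicate m v" u "\<tau> u" v] Cons.prems
        by (simp add: eq_neg_iff_add_eq_0)
      also have "H (v # us @ replicate m v) = H (us @ replicate (Suc m) v)"
        by (rule H_perm) (use Cons.prems in auto)
      also have "\<dots> = (\<Prod>u\<leftarrow>us. - \<tau> u) * H (replicate k v)"
        using Cons.prems by (intro Cons.IH) auto
      finally show ?case by simp
    qed simp
    have scale: "(\<Prod>u\<leftarrow>us. \<kappa> * - \<tau> u) = \<kappa> ^ length us * (\<Prod>u\<leftarrow>us. - \<tau> u)" for us
      by (induction us) auto
    have "H us = (\<Prod>u\<leftarrow>us. \<kappa> * - \<tau> u)" if "length us = k" for us
      using *[of us 0] that \<kappa> scale[of us] by simp
    then show ?thesis by (intro exI[of _ "\<lambda>u. \<kappa> * - \<tau> u"]) blast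
  qed
qed

end

subsection \<open>Contraction of tensors\<close>

text \<open>This is the multilinear form of \<open>g\<close>, with one covector per leg. The
  coordinates of a restriction are its values at rows of the matrices.\<close>

definition contract :: "nat \<Rightarrow> 'i set \<Rightarrow> ('i, 'a::field) tensor \<Rightarrow> (nat \<Rightarrow> 'i \<Rightarrow> 'a) \<Rightarrow> 'a"
  where "contract k J g v = (\<Sum>ys \<in> multi_index k J. (\<Prod>l<k. v l (ys ! l)) * g ys)"

lemma apply_tensor_maps_eq_contract:
  "apply_tensor_maps k J A g xs = contract k J g (\<lambda>l. A l (xs ! l))"
  by (simp add: apply_tensor_maps_def contract_def)

lemma contract_cong:
  assumes "\<And>l y. l < k \<Longrightarrow> y \<in> J \<Longrightarrow> v l y = w l y"
  shows "contract k J g v = contract k J g w"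
  unfolding contract_def
  by (intro sum.cong prod.cong arg_cong2[of _ _ _ _ "(*)"] refl assms)
    (auto simp: multi_index_def)

lemma finite_multi_index: "finite J \<Longrightarrow> finite (multi_index n J)"
  unfolding multi_index_def by (rule finite_lists_length_eq)

lemma permute_list_multi_index:
  "\<pi> permutes {..<k} \<Longrightarrow> xs \<in> multi_index k I \<Longrightarrow> permute_list \<pi> xs \<in> multi_index k I"
  by (auto simp: multi_index_def)

text \<open>Permuting the covectors amounts to permuting the summation indices, which the symmetric
  \<open>g\<close> does not notice.\<close>

lemma contract_permute:
  assumes g: "symmetric_tensor k J g" and \<pi>: "\<pi> permutes {..<k}"
  shows "contract k J g (\<lambda>l. v (\<pi> l)) = contract k J g v"
  unfolding contract_def
proof (rule sum.reindex_bij_witness[where i = "permute_list \<pi>" and j = "permute_list (inv \<pi>)"])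
  fix ys assume ys: "ys \<in> multi_index k J"
  have inv: "inv \<pi> permutes {..<k}" using \<pi> by (rule permutes_inv)
  have len: "length ys = k" using ys by (simp add: multi_index_def)
  show "permute_list \<pi> (permute_list (inv \<pi>) ys) = ys"
    using permute_list_compose[of \<pi> ys "inv \<pi>"] \<pi> len by (simp add: permutes_inv_o)
  show "permute_list (inv \<pi>) (permute_list \<pi> ys) = ys"
    using permute_list_compose[of "inv \<pi>" ys "\<pi>"] inv len \<pi> by (simp add: permutes_inv_o)
  show "permute_list \<pi> ys \<in> multi_index k J" "permute_list (inv \<pi>) ys \<in> multi_index k J"
    using ys \<pi> inv by (auto intro: permute_list_multi_index)
  have "(\<Prod>l<k. v l (permute_list (inv \<pi>) ys ! l)) = (\<Prod>l<k. v (\<pi> l) (permute_list (inv \<pi>) ys ! \<pi> l))"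
    by (rule prod.permute[OF \<pi>, unfolded comp_def])
  also have "\<dots> = (\<Prod>l<k. v (\<pi> l) (ys ! l))"
    using len \<pi> inv permutes_in_image[OF \<pi>]
    by (intro prod.cong) (auto simp: permute_list_nth permutes_inverses)
  moreover have "g (permute_list (inv \<pi>) ys) = g ys"
    using g inv ys by (auto simp: symmetric_tensor_def)
  ultimately show "(\<Prod>l<k. v l (permute_list (inv \<pi>) ys ! l)) * g (permute_list (inv \<pi>) ys) =
    (\<Prod>l<k. v (\<pi> l) (ys ! l)) * g ys" by simp
qed

lemma contract_mset_eq:
  assumes g: "symmetric_tensor k J g" and len: "length us = k" and eq: "mset us = mset vs"
  shows "contract k J g ((!) us) = contract k J g ((!) vs)"
proof -
  obtain \<pi> where \<pi>: "\<pi> permutes {..<k}" "permute_list \<pi> vs = us"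
    using mset_eq_permutation[OF eq] len by (metis eq mset_eq_length)
  have "length vs = k" using eq len by (metis mset_eq_length)
  then have "contract k J g ((!) us) = contract k J g (\<lambda>l. vs ! \<pi> l)"
    using \<pi> by (intro contract_cong) (auto simp: permute_list_nth)
  then show ?thesis using contract_permute[OF g \<pi>(1), of "(!) vs"] by simp
qed

lemma contract_linear:
  "contract (Suc k) J g ((!) ((\<lambda>i. u i + t * v i) # vs)) =
    contract (Suc k) J g ((!) (u # vs)) + t * contract (Suc k) J g ((!) (v # vs))"
  by (simp add: contract_def prod.lessThan_Suc_shift del: prod.lessThan_Suc)
    (simp add: sum_distrib_left sum.distrib algebra_simps)

lemma contract_symmetric_form:
  fixes g :: "('i, 'a::alg_closed_field) tensor"
  assumes "symmetric_tensor k J g" "k \<ge> 1" "CHAR('a) = 0 \<or> CHAR('a) \<ge> k + 1"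
  shows "symmetric_form k (\<lambda>vs. contract k J g ((!) vs))"
proof
  fix vs :: "('i \<Rightarrow> 'a) list" and u v t
  assume "Suc (length vs) = k"
  then show "contract k J g ((!) ((\<lambda>i. u i + t * v i) # vs)) =
      contract k J g ((!) (u # vs)) + t * contract k J g ((!) (v # vs))"
    using contract_linear by blast
qed (use assms contract_mset_eq[OF assms(1)] in blast)+

text \<open>Coordinates are recovered from the form, so that a factorization of the form passes to
  the tensor itself.\<close>

lemma contract_unit_vectors:
  fixes g :: "('i, 'c::field) tensor"
  assumes "finite J" and ys: "ys \<in> multi_index k J"
  shows "contract k J g (\<lambda>l i. if i = ys ! l then 1 else 0) = g ys"
proof -
  have "(\<Prod>l<k. if zs ! l = ys ! l then 1 else 0) * g zs = (if zs = ys then g ys else 0)"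
    if zs: "zs \<in> multi_index k J" for zs
  proof (cases "zs = ys")
    case False
    then obtain l where "l < k" "zs ! l \<noteq> ys ! l"
      using zs ys unfolding multi_index_def list_eq_iff_nth_eq by auto
    then have "(\<Prod>l<k. if zs ! l = ys ! l then 1 else (0::'c)) = 0" by auto
    then show ?thesis using False by simp
  qed simp
  then have "contract k J g (\<lambda>l i. if i = ys ! l then 1 else 0) =
      (\<Sum>zs \<in> multi_index k J. if zs = ys then g ys else 0)"
    unfolding contract_def by (intro sum.cong) auto
  then show ?thesis using assms finite_multi_index[of J k] by simp
qed

section \<open>Tensor powers and product covectors\<close>

lemma tensor_power_symmetric:
  assumes "symmetric_tensor k I f"
  shows "symmetric_tensor k (multi_index n I) (tensor_power n f)"
  unfolding symmetric_tensor_def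
proof (intro allI impI ballI)
  fix \<pi> xs assume \<pi>: "\<pi> permutes {..<k}" and xs: "xs \<in> multi_index k (multi_index n I)"
  have "f (map (\<lambda>x. x ! m) (permute_list \<pi> xs)) = f (map (\<lambda>x. x ! m) xs)" if "m < n" for m
  proof -
    have "map (\<lambda>x. x ! m) xs \<in> multi_index k I"
      using xs that by (auto simp: multi_index_def subset_iff)
    moreover have "map (\<lambda>x. x ! m) (permute_list \<pi> xs) = permute_list \<pi> (map (\<lambda>x. x ! m) xs)"
      using \<pi> xs by (simp add: permute_list_map multi_index_def)
    ultimately show ?thesis using assms \<pi> by (simp add: symmetric_tensor_def)
  qed
  then show "tensor_power n f (permute_list \<pi> xs) = tensor_power n f xs"
    by (simp add: tensor_power_def)
qed

lemma prod_sum_multi_index: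
  assumes "finite J"
  shows "(\<Prod>l<k. \<Sum>i\<in>J. F l i) = (\<Sum>js \<in> multi_index k J. \<Prod>l<k. (F l (js ! l) :: 'a::comm_semiring_1))"
  using assms
proof (subst prod_sum_PiE)
  show "(\<Sum>h \<in> {..<k} \<rightarrow>\<^sub>E J. \<Prod>l<k. F l (h l)) = (\<Sum>js \<in> multi_index k J. \<Prod>l<k. F l (js ! l))"
    by (rule sum.reindex_bij_witness[where j = "\<lambda>h. map h [0..<k]" and i = "\<lambda>js. \<lambda>l\<in>{..<k}. js ! l"])
      (auto simp: multi_index_def PiE_def extensional_def list_eq_iff_nth_eq fun_eq_iff subset_iff)
qed auto

text \<open>With product covectors the big sum splits into \<open>n\<close> independent ones. The
  bijection transposes the array of indices: \<open>k\<close> words of length \<open>n\<close>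
  against \<open>n\<close> lists of length \<open>k\<close>.\<close>

lemma contract_tensor_power:
  fixes g :: "('i, 'a::field) tensor"
  assumes "finite J"
  shows "contract k (multi_index n J) (tensor_power n g) (\<lambda>l y. \<Prod>m<n. w l m (y ! m)) =
    (\<Prod>m<n. contract k J g (\<lambda>l. w l m))"
proof -
  let ?F = "\<lambda>m zs. (\<Prod>l<k. w l m (zs ! l)) * g zs"
  have "(\<Prod>m<n. contract k J g (\<lambda>l. w l m)) =
      (\<Sum>h \<in> {..<n} \<rightarrow>\<^sub>E multi_index k J. \<Prod>m<n. ?F m (h m))"
    unfolding contract_def by (rule prod_sum_PiE) (auto intro: finite_multi_index assms)
  also have "\<dots> = contract k (multi_index n J) (tensor_power n g) (\<lambda>l y. \<Prod>m<n. w l m (y ! m))"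
    unfolding contract_def
  proof (rule sum.reindex_bij_witness[where j = "\<lambda>h. map (\<lambda>l. map (\<lambda>m. h m ! l) [0..<n]) [0..<k]"
        and i = "\<lambda>ys. \<lambda>m\<in>{..<n}. map (\<lambda>y. y ! m) ys"])
    fix h assume h: "h \<in> {..<n} \<rightarrow>\<^sub>E multi_index k J"
    let ?ys = "map (\<lambda>l. map (\<lambda>m. h m ! l) [0..<n]) [0..<k]"
    have h': "map (\<lambda>y. y ! m) ?ys = h m" if "m < n" for m
      using h that by (auto simp: multi_index_def list_eq_iff_nth_eq PiE_iff)
    show "(\<lambda>m\<in>{..<n}. map (\<lambda>y. y ! m) ?ys) = h"
      using h h' by (auto simp: fun_eq_iff PiE_iff extensional_def)
    have "h m ! l \<in> J" if "m < n" "l < k" for m l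
    proof -
      have "h m \<in> multi_index k J" using h that by auto
      then show ?thesis using that nth_mem[of l "h m"] by (auto simp: multi_index_def)
    qed
    then show "?ys \<in> multi_index k (multi_index n J)"
      by (auto simp: multi_index_def)
    have "tensor_power n g ?ys = (\<Prod>m<n. g (h m))"
      unfolding tensor_power_def using h' by (intro prod.cong) auto
    moreover have "(\<Prod>l<k. \<Prod>m<n. w l m (?ys ! l ! m)) = (\<Prod>m<n. \<Prod>l<k. w l m (h m ! l))"
      by (subst prod.swap) simp
    ultimately show "(\<Prod>l<k. \<Prod>m<n. w l m (?ys ! l ! m)) * tensor_power n g ?ys =
        (\<Prod>m<n. ?F m (h m))"
      by (simp add: prod.distrib)
  next
    fix ys assume ys: "ys \<in> multi_index k (multi_index n J)"
    then show "map (\<lambda>l. map (\<lambda>m. (\<lambda>m\<in>{..<n}. map (\<lambda>y. y ! m) ys) m ! l) [0..<n]) [0..<k] = ys"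
      by (auto simp: multi_index_def list_eq_iff_nth_eq subset_iff)
    show "(\<lambda>m\<in>{..<n}. map (\<lambda>y. y ! m) ys) \<in> {..<n} \<rightarrow>\<^sub>E multi_index k J"
      using ys by (auto simp: multi_index_def subset_iff)
  qed
  finally show ?thesis ..
qed

lemma tensor_power_append:
  assumes "length ys = length zs" "set ys \<subseteq> multi_index n J"
  shows "tensor_power (n + c) g (map2 (@) ys zs) = tensor_power n g ys * tensor_power c g zs"
proof -
  have 1: "map (\<lambda>x. x ! m) (map2 (@) ys zs) = map (\<lambda>x. x ! m) ys" if "m < n" for m
    using assms that
    by (auto simp: list_eq_iff_nth_eq multi_index_def nth_append subset_iff)
  have 2: "map (\<lambda>x. x ! (n + m)) (map2 (@) ys zs) = map (\<lambda>x. x ! m) zs" for m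
    using assms by (auto simp: list_eq_iff_nth_eq multi_index_def nth_append subset_iff)
  have "tensor_power (n + c) g (map2 (@) ys zs) =
      (\<Prod>m<n. g (map (\<lambda>x. x ! m) (map2 (@) ys zs))) *
      (\<Prod>m<c. g (map (\<lambda>x. x ! (n + m)) (map2 (@) ys zs)))"
    unfolding tensor_power_def
    by (induction c) (auto simp: mult.assoc)
  then show ?thesis unfolding 2 using 1 by (simp add: tensor_power_def)
qed

text \<open>Cutting each word after \<open>n\<close> letters identifies the power with a product of
  two powers. This is how the additional \<open>c\<close> factors are attached.\<close>

lemma contract_tensor_power_add:
  fixes g :: "('i, 'a::field) tensor"
  shows "contract k (multi_index (n + c) J) (tensor_power (n + c) g)
      (\<lambda>l y. u l (take n y) * v l (drop n y)) =
    contract k (multi_index n J) (tensor_power n g) u *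
    contract k (multi_index c J) (tensor_power c g) v"
  unfolding contract_def sum_product sum.cartesian_product
proof (rule sum.reindex_bij_witness[where i = "\<lambda>(ys, zs). map2 (@) ys zs"
      and j = "\<lambda>xs. (map (take n) xs, map (drop n) xs)"], goal_cases)
  case (1 xs)
  then show ?case by (auto simp: list_eq_iff_nth_eq)
next
  case (2 xs)
  then show ?case by (auto simp: multi_index_def subset_iff dest: in_set_takeD in_set_dropD)
next
  case (3 p)
  then show ?case by (auto simp: multi_index_def list_eq_iff_nth_eq subset_iff)
next
  case (4 p)
  then have "x @ y \<in> multi_index (n + c) J" if "(x, y) \<in> set (zip (fst p) (snd p))" for x y
    using set_zip_leftD[OF that] set_zip_rightD[OF that] by (auto simp: multi_index_def subset_iff)
  then have "set (map2 (@) (fst p) (snd p)) \<subseteq> multi_index (n + c) J" by auto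
  moreover have "length (map2 (@) (fst p) (snd p)) = k" using 4 by (auto simp: multi_index_def)
  ultimately show ?case
    unfolding multi_index_def[of k] by (simp add: case_prod_beta)
next
  case (5 xs)
  let ?ys = "map (take n) xs" and ?zs = "map (drop n) xs"
  have "tensor_power (n + c) g (map2 (@) ?ys ?zs) = tensor_power n g ?ys * tensor_power c g ?zs"
    by (rule tensor_power_append)
      (use 5 in \<open>auto simp: multi_index_def subset_iff dest: in_set_takeD\<close>)
  moreover have "map2 (@) ?ys ?zs = xs"
    by (auto simp: list_eq_iff_nth_eq)
  ultimately show ?case using 5
    by (simp add: multi_index_def prod.distrib)
qed

subsection \<open>Restriction of a power to a monomial\<close>

lemma length_filter_eq_sum_count:
  "finite K \<Longrightarrow> length (filter (\<lambda>j. j \<in> K) js) = (\<Sum>i\<in>K. count (mset js) i)"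
proof (induction js)
  case (Cons j js)
  have "(\<Sum>i\<in>K. count (mset (j # js)) i) = (\<Sum>i\<in>K. count (mset js) i + (if j = i then 1 else 0))"
    by (intro sum.cong) auto
  also have "\<dots> = (\<Sum>i\<in>K. count (mset js) i) + (if j \<in> K then 1 else 0)"
    using Cons.prems by (simp add: sum.distrib)
  finally show ?case using Cons by simp
qed simp

text \<open>Let \<open>K\<close> be an \<open>a\<close>-subset of least total multiplicity. By
  exchange, no multiplicity in \<open>K\<close> exceeds one outside. As \<open>K\<close> has total
  at least \<open>a\<close>, the outside ones are positive with total at most \<open>k - a\<close>,
  hence all 1, and those in \<open>K\<close> are at most 1.\<close>

lemma distinct_if_many_in_subsets:
  assumes js: "set js \<subseteq> {..<k}" "length js = k" and a: "1 \<le> a" "a < k"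
    and many: "\<And>K. K \<subseteq> {..<k} \<Longrightarrow> card K = a \<Longrightarrow> a \<le> length (filter (\<lambda>j. j \<in> K) js)"
  shows "distinct js"
proof -
  define m where "m = count (mset js)"
  have many': "a \<le> sum m K" if "K \<subseteq> {..<k}" "card K = a" for K
    using many[OF that] length_filter_eq_sum_count[of K js] that(1)
    by (simp add: m_def finite_subset)
  have total: "sum m {..<k} = k"
    using length_filter_eq_sum_count[of "{..<k}" js] js by (simp add: m_def subset_iff filter_id_conv)
  let ?P = "\<lambda>K. K \<subseteq> {..<k} \<and> card K = a"
  have "?P {..<a}" using a by auto
  then obtain K where K: "K \<subseteq> {..<k}" "card K = a" and min: "\<And>K'. ?P K' \<Longrightarrow> sum m K \<le> sum m K'"
    using ex_has_least_nat[of ?P "{..<a}" "sum m"] by auto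
  have fin: "finite K" using K finite_subset by blast
  define C where "C = {..<k} - K"
  have C: "card C = k - a" "finite C" using K fin by (auto simp: C_def card_Diff_subset)
  have split: "sum m K + sum m C = k"
    using total K by (simp add: C_def sum.subset_diff[of K "{..<k}"] add.commute)
  have exch: "m i \<le> m i'" if "i \<in> K" "i' \<in> C" for i i'
  proof -
    let ?K = "insert i' (K - {i})"
    have "card ?K = a" using that K fin C_def
      by (metis DiffD1 DiffD2 card.insert card_Suc_Diff1 finite_Diff)
    then have "sum m K \<le> sum m ?K" using that K by (intro min) (auto simp: C_def)
    moreover have "sum m ?K = m i' + sum m (K - {i})" using that fin by (simp add: C_def)
    moreover have "sum m K = m i + sum m (K - {i})" using that fin by (simp add: sum.remove)
    ultimately show ?thesis by simp
  qed
  have "\<exists>i0\<in>K. m i0 \<noteq> 0"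
  proof (rule ccontr)
    assume "\<not> ?thesis"
    then have "sum m K = 0" by simp
    then show False using many'[OF K] a by simp
  qed
  then have C1: "1 \<le> m i" if "i \<in> C" for i using exch that by fastforce
  have C2: "m i \<le> 1" if "i \<in> C" for i
  proof (rule ccontr)
    assume m: "\<not> m i \<le> 1"
    have "sum (\<lambda>_. 1) C < sum m C"
    proof (rule sum_strict_mono_ex1)
      show "\<exists>i\<in>C. 1 < m i" using that m by force
    qed (use C C1 in auto)
    then show False using split many'[OF K] C by simp
  qed
  obtain i' where "i' \<in> C" using C a by fastforce
  then have "m i \<le> 1" if "i \<in> K" for i using exch[OF that] C2 by fastforce
  then have le: "m i \<le> 1" if "i \<in> set js" for i using C2 that js by (cases "i \<in> K") (auto simp: C_def)
  show ?thesis unfolding distinct_count_atmost_1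
  proof
    fix i show "count (mset js) i = (if i \<in> set js then 1 else 0)"
      using le[of i] by (auto simp: m_def le_Suc_eq)
  qed
qed

lemma mset_map_if:
  "mset (map (\<lambda>j. if P j then x else y) js) =
    mset (replicate (length (filter P js)) x @ replicate (length js - length (filter P js)) y)"
  by (induction js) (auto simp: Suc_diff_le)

text \<open>
  The power of \<open>g\<close> restricts to the symmetric tensor of the monomial \<open>x\<^sub>1 \<cdots> x\<^sub>k\<close>: take one
  factor for each \<open>a\<close>-subset \<open>K\<close> of the \<open>k\<close> variables, with the \<open>i\<close>-th vector being \<open>w1\<close> if
  \<open>i \<in> K\<close> and \<open>w0\<close> otherwise. A choice of variables \<open>js\<close> survives only if every \<open>K\<close> contains at
  least \<open>a\<close> of its entries, which forces it to be a permutation.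
\<close>

lemma power_restricts_to_monomial:
  fixes g :: "('i, 'a::field) tensor"
  assumes "finite J" and g: "symmetric_tensor k J g" and a: "1 \<le> a" "a < k"
    and nz: "contract k J g ((!) (replicate a w1 @ replicate (k - a) w0)) \<noteq> 0"
    and z: "\<And>b. b < a \<Longrightarrow> contract k J g ((!) (replicate b w1 @ replicate (k - b) w0)) = 0"
  shows "\<exists>c W \<theta>. \<theta> \<noteq> 0 \<and> (\<forall>js \<in> multi_index k {..<k}.
    contract k (multi_index c J) (tensor_power c g) (\<lambda>l. W (js ! l)) = (if distinct js then \<theta> else 0))"
proof -
  define \<gamma> where "\<gamma> b = contract k J g ((!) (replicate b w1 @ replicate (k - b) w0))" for b
  have fin: "finite {K. K \<subseteq> {..<k} \<and> card K = a}" by simp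
  \<comment> \<open>Each entry of \<open>Ks\<close> labels one tensor factor; only that every
    \<open>a\<close>-subset occurs matters below.\<close>
  then obtain Ks where Ks: "set Ks = {K. K \<subseteq> {..<k} \<and> card K = a}" using finite_list[OF fin] by auto
  define c where "c = length Ks"
  define W where "W i y = (\<Prod>m<c. (if i \<in> Ks ! m then w1 else w0) (y ! m))" for i y
  have "contract k (multi_index c J) (tensor_power c g) (\<lambda>l. W (js ! l)) = (if distinct js then \<gamma> a ^ c else 0)"
    if js: "js \<in> multi_index k {..<k}" for js
  proof -
    have len: "length js = k" and sub: "set js \<subseteq> {..<k}" using js by (auto simp: multi_index_def)
    have count: "contract k J g (\<lambda>l. if js ! l \<in> K then w1 else w0) = \<gamma> (length (filter (\<lambda>j. j \<in> K) js))" for K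
    proof -
      have "contract k J g (\<lambda>l. if js ! l \<in> K then w1 else w0) =
          contract k J g ((!) (map (\<lambda>j. if j \<in> K then w1 else w0) js))"
        by (rule contract_cong) (auto simp: len)
      also have "\<dots> = \<gamma> (length (filter (\<lambda>j. j \<in> K) js))"
        unfolding \<gamma>_def using mset_map_if[of "\<lambda>j. j \<in> K" w1 w0 js] len
        by (intro contract_mset_eq[OF g]) auto
      finally show ?thesis .
    qed
    have "contract k (multi_index c J) (tensor_power c g) (\<lambda>l. W (js ! l)) =
        (\<Prod>m<c. contract k J g (\<lambda>l. if js ! l \<in> Ks ! m then w1 else w0))"
      unfolding W_def by (rule contract_tensor_power) (use assms in auto)
    also have "\<dots> = (\<Prod>m<c. \<gamma> (length (filter (\<lambda>j. j \<in> Ks ! m) js)))"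
      by (simp only: count)
    also have "\<dots> = (if distinct js then \<gamma> a ^ c else 0)"
    proof (cases "distinct js")
      \<comment> \<open>Here \<open>js\<close> is a permutation, so every \<open>a\<close>-subset
        contains exactly \<open>a\<close> of its entries and each factor is
        \<open>\<gamma> a\<close>.\<close>
      case True
      then have set_js: "set js = {..<k}"
        using sub len by (intro card_subset_eq) (auto simp: distinct_card)
      have "length (filter (\<lambda>j. j \<in> Ks ! m) js) = a" if "m < c" for m
      proof -
        have "Ks ! m \<subseteq> {..<k}" "card (Ks ! m) = a" using Ks that nth_mem[of m Ks] by (auto simp: c_def)
        moreover have "{j. j < k \<and> j \<in> Ks ! m} = Ks ! m" using \<open>Ks ! m \<subseteq> {..<k}\<close> by auto
        ultimately show ?thesis
          using True set_js distinct_card[of "filter (\<lambda>j. j \<in> Ks ! m) js"] by simp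
      qed
      then show ?thesis using True by simp
    next
      case False
      then obtain K where K: "K \<subseteq> {..<k}" "card K = a" "length (filter (\<lambda>j. j \<in> K) js) < a"
        using distinct_if_many_in_subsets[OF sub len a] by (metis not_less)
      then have "K \<in> set Ks" by (simp add: Ks)
      then obtain m where m: "m < c" "Ks ! m = K" by (auto simp: in_set_conv_nth c_def)
      then have "\<gamma> (length (filter (\<lambda>j. j \<in> Ks ! m) js)) = 0"
        using K z by (simp add: \<gamma>_def)
      with m have "\<exists>m\<in>{..<c}. \<gamma> (length (filter (\<lambda>j. j \<in> Ks ! m) js)) = 0" by auto
      then show ?thesis using False by auto
    qed
    finally show ?thesis .
  qed
  moreover have "\<gamma> a ^ c \<noteq> 0" using nz by (simp add: \<gamma>_def)
  ultimately show ?thesis by blast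
qed

section \<open>Symmetrization of a restriction\<close>

lemma contract_scale: "contract k J g (\<lambda>l y. t * v l y) = t ^ k * contract k J g v"
  by (simp add: contract_def prod.distrib sum_distrib_left mult.assoc)

lemma contract_sum:
  assumes "finite S"
  shows "contract k J g (\<lambda>l y. \<Sum>i\<in>S. F l i y) =
    (\<Sum>js \<in> multi_index k S. contract k J g (\<lambda>l. F l (js ! l)))"
  by (simp add: contract_def prod_sum_multi_index[OF assms] sum_distrib_right sum.swap[of _ "multi_index k S"])

text \<open>
  Contracting the additional factor with the functionals \<open>W\<close> picks out the symmetrization of the
  given restriction, which has the same image because \<open>f\<close> is symmetric.
\<close>

lemma symmetrize_restriction:
  fixes g :: "('i, 'a::alg_closed_field) tensor"
  assumes g: "symmetric_tensor k J g" and f: "symmetric_tensor k X f" and "k \<ge> 1"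
    and fact: "of_nat (fact k) \<noteq> (0::'a)" and \<theta>: "\<theta> \<noteq> 0"
    and W: "\<And>js. js \<in> multi_index k {..<k} \<Longrightarrow>
      contract k (multi_index c J) (tensor_power c g) (\<lambda>l. W (js ! l)) = (if distinct js then \<theta> else 0)"
    and r: "restricts k X f (multi_index N J) (tensor_power N g)"
  shows "sym_restricts k X f (multi_index (N + c) J) (tensor_power (N + c) g)"
proof -
  let ?Y = "multi_index N J" and ?G = "tensor_power N g"
  obtain A where A: "\<And>xs. xs \<in> multi_index k X \<Longrightarrow> f xs = contract k ?Y ?G (\<lambda>l. A l (xs ! l))"
    using r unfolding restricts_def apply_tensor_maps_eq_contract by blast
  \<comment> \<open>The factor is chosen to cancel \<open>\<theta>\<close> from each surviving term
    and the number \<open>fact k\<close> of such terms.\<close>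
  obtain \<kappa> where \<kappa>: "\<kappa> ^ k = inverse (\<theta> * of_nat (fact k))"
    using nth_root_exists[of k "inverse (\<theta> * of_nat (fact k))"] \<open>k \<ge> 1\<close> by auto
  \<comment> \<open>The single map adds up all \<open>A i\<close>, each tagged by \<open>W i\<close>
    on the last \<open>c\<close> letters. In the expansion the tags eliminate every choice of maps
    that is not a permutation.\<close>
  define B where "B x y = \<kappa> * (\<Sum>i<k. A i x (take N y) * W i (drop N y))" for x y
  \<comment> \<open>Reordering the maps has the same effect as reordering \<open>xs\<close>
    inversely, which the symmetry of \<open>f\<close> absorbs.\<close>
  have perm: "contract k ?Y ?G (\<lambda>l. A (js ! l) (xs ! l)) = f xs"
    if xs: "xs \<in> multi_index k X" and js: "js \<in> multi_index k {..<k}" "distinct js" for xs js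
  proof -
    define \<sigma> where "\<sigma> l = (if l < k then js ! l else l)" for l
    have len: "length js = k" "set js \<subseteq> {..<k}" "length xs = k"
      using js xs by (auto simp: multi_index_def)
    then have set_js: "set js = {..<k}" using js by (intro card_subset_eq) (auto simp: distinct_card)
    have "bij_betw ((!) js) {..<k} {..<k}"
      by (rule bij_betw_nth) (simp_all only: js len(1) set_js)
    then have "bij_betw \<sigma> {..<k} {..<k}" by (subst bij_betw_cong[of _ _ "(!) js"]) (auto simp: \<sigma>_def)
    then have \<sigma>: "\<sigma> permutes {..<k}" by (rule bij_imp_permutes) (auto simp: \<sigma>_def)
    note inv = permutes_inv[OF \<sigma>]
    have "contract k ?Y ?G (\<lambda>l. A (js ! l) (xs ! l)) = contract k ?Y ?G (\<lambda>l. A (\<sigma> l) (xs ! l))"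
      by (rule contract_cong) (auto simp: \<sigma>_def)
    also have "\<dots> = contract k ?Y ?G (\<lambda>l. A (\<sigma> (inv \<sigma> l)) (xs ! inv \<sigma> l))"
      using contract_permute[OF tensor_power_symmetric[OF g] inv, of N "\<lambda>l. A (\<sigma> l) (xs ! l)"] by simp
    also have "\<dots> = contract k ?Y ?G (\<lambda>l. A l (permute_list (inv \<sigma>) xs ! l))"
      using inv len by (intro contract_cong) (simp add: permute_list_nth permutes_inverses[OF \<sigma>])
    also have "\<dots> = f (permute_list (inv \<sigma>) xs)"
      using A permute_list_multi_index[OF inv xs] by simp
    also have "\<dots> = f xs" using f inv xs by (simp add: symmetric_tensor_def)
    finally show ?thesis .
  qed
  have "contract k (multi_index (N + c) J) (tensor_power (N + c) g) (\<lambda>l. B (xs ! l)) = f xs"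
    if xs: "xs \<in> multi_index k X" for xs
  proof -
    have "contract k (multi_index (N + c) J) (tensor_power (N + c) g) (\<lambda>l. B (xs ! l)) =
        \<kappa> ^ k * (\<Sum>js \<in> multi_index k {..<k}. contract k (multi_index (N + c) J) (tensor_power (N + c) g)
          (\<lambda>l y. A (js ! l) (xs ! l) (take N y) * W (js ! l) (drop N y)))"
      unfolding B_def by (simp add: contract_scale contract_sum)
    also have "\<dots> = \<kappa> ^ k * (\<Sum>js \<in> multi_index k {..<k}.
        contract k ?Y ?G (\<lambda>l. A (js ! l) (xs ! l)) * (if distinct js then \<theta> else 0))"
      by (intro arg_cong[of _ _ "(*) _"] sum.cong refl)
        (simp only: W contract_tensor_power_add
          [where u = "\<lambda>l. A (_ l) (xs ! l)" and v = "\<lambda>l. W (_ l)"])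
    also have "\<dots> = \<kappa> ^ k * (\<Sum>js \<in> multi_index k {..<k}. if distinct js then f xs * \<theta> else 0)"
      using perm[OF xs] by (intro arg_cong[of _ _ "(*) _"] sum.cong) auto
    also have "\<dots> = \<kappa> ^ k * (of_nat (card {js \<in> multi_index k {..<k}. distinct js}) * (f xs * \<theta>))"
      by (subst sum.inter_filter[symmetric]) (auto intro: finite_multi_index)
    also have "card {js \<in> multi_index k {..<k}. distinct js} = fact k"
    proof -
      have "{js \<in> multi_index k {..<k}. distinct js} =
          {js. length js = k \<and> distinct js \<and> set js \<subseteq> {..<k}}"
        by (auto simp: multi_index_def)
      then show ?thesis
        using card_lists_distinct_length_eq[of "{..<k}" k] by (simp add: fact_prod)
    qed
    also have "\<kappa> ^ k * (of_nat (fact k) * (f xs * \<theta>)) = f xs"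
      using \<kappa> fact \<theta> by (simp add: field_simps)
    finally show ?thesis .
  qed
  then show ?thesis unfolding sym_restricts_def apply_tensor_maps_eq_contract by metis
qed

section \<open>The rank-one case\<close>

text \<open>The image of a product tensor is a product of functions \<open>b l\<close>. If it is
  symmetric and nonzero, all \<open>b l\<close> are proportional to \<open>b 0\<close>, and a
  \<open>k\<close>-th root of the product of the ratios gives one common map.\<close>

lemma sym_restricts_rank_one:
  fixes G :: "('j, 'a::alg_closed_field) tensor"
  assumes "finite Y" and f: "symmetric_tensor k X f" and "k \<ge> 1"
    and G: "\<And>ys. ys \<in> multi_index k Y \<Longrightarrow> G ys = (\<Prod>l<k. L (ys ! l))"
    and r: "restricts k X f Y G"
  shows "sym_restricts k X f Y G"
proof -
  have contract: "contract k Y G v = (\<Prod>l<k. \<Sum>y\<in>Y. v l y * L y)" for v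
    unfolding contract_def by (simp add: G prod_sum_multi_index[OF \<open>finite Y\<close>] prod.distrib)
  obtain A where A: "\<And>xs. xs \<in> multi_index k X \<Longrightarrow> f xs = contract k Y G (\<lambda>l. A l (xs ! l))"
    using r unfolding restricts_def apply_tensor_maps_eq_contract by blast
  define b where "b l x = (\<Sum>y\<in>Y. A l x y * L y)" for l x
  have b: "f xs = (\<Prod>l<k. b l (xs ! l))" if "xs \<in> multi_index k X" for xs
    using A[OF that] by (simp add: contract b_def)
  show ?thesis
  proof (cases "\<forall>xs \<in> multi_index k X. f xs = 0")
    case True
    then show ?thesis using \<open>k \<ge> 1\<close>
      unfolding sym_restricts_def apply_tensor_maps_eq_contract contract
      by (intro exI[of _ "\<lambda>_ _. 0"]) auto
  next
    case False
    then obtain zs where zs: "zs \<in> multi_index k X" "f zs \<noteq> 0" by blast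
    have nz: "b l (zs ! l) \<noteq> 0" if "l < k" for l using zs b that by auto
    have len: "length zs = k"
      using zs by (auto simp: multi_index_def)
    \<comment> \<open>Put \<open>x\<close> at position \<open>l\<close> of \<open>zs\<close> and
      swap positions 0 and \<open>l\<close>: symmetry equates two products whose remaining factors
      agree and are nonzero.\<close>
    have proportional: "b l x * b 0 (zs ! 0) = b l (zs ! 0) * b 0 x" if "x \<in> X" "l < k" for x l
    proof (cases "l = 0")
      case False
      define R where "R = {..<k} - {0, l}"
      have R: "{..<k} = insert 0 (insert l R)" "0 \<notin> insert l R" "l \<notin> R" "finite R"
        using that False by (auto simp: R_def)
      let ?xs = "zs[l := x]" and ?p = "transpose 0 l"
      let ?xs' = "permute_list ?p ?xs"
      have \<pi>: "?p permutes {..<k}" using that by (intro permutes_swap_id) auto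
      have xs: "?xs \<in> multi_index k X"
        using zs that set_update_subset_insert[of zs l x] by (auto simp: multi_index_def)
      have nth: "?xs' ! i = ?xs ! (?p i)" if "i < k" for i
        using that \<pi> len by (simp add: permute_list_nth)
      have "f ?xs' = f ?xs" using f \<pi> xs by (simp add: symmetric_tensor_def)
      then have "(\<Prod>i<k. b i (?xs' ! i)) = (\<Prod>i<k. b i (?xs ! i))"
        using b xs permute_list_multi_index[OF \<pi> xs] by simp
      then have "b 0 (?xs' ! 0) * (b l (?xs' ! l) * (\<Prod>i\<in>R. b i (?xs' ! i))) =
          b 0 (?xs ! 0) * (b l (?xs ! l) * (\<Prod>i\<in>R. b i (?xs ! i)))"
        using R by simp
      moreover have "?xs' ! 0 = x" "?xs' ! l = zs ! 0" "?xs ! 0 = zs ! 0" "?xs ! l = x"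
        using nth that False len by auto
      moreover have "(\<Prod>i\<in>R. b i (?xs' ! i)) = (\<Prod>i\<in>R. b i (zs ! i))"
        "(\<Prod>i\<in>R. b i (?xs ! i)) = (\<Prod>i\<in>R. b i (zs ! i))"
        using nth by (auto simp: R_def intro!: prod.cong)
      moreover have "(\<Prod>i\<in>R. b i (zs ! i)) \<noteq> 0" using nz R(4) by (auto simp: R_def)
      ultimately show ?thesis by (simp add: mult.commute)
    qed simp
    have nz0: "b 0 (zs ! 0) \<noteq> 0" using nz \<open>k \<ge> 1\<close> by simp
    define r where "r l = b l (zs ! 0) / b 0 (zs ! 0)" for l
    have br: "b l x = r l * b 0 x" if "x \<in> X" "l < k" for x l
      using proportional[OF that] nz0 by (simp add: r_def field_simps)
    obtain \<kappa> where \<kappa>: "\<kappa> ^ k = (\<Prod>l<k. r l)" using nth_root_exists[of k "\<Prod>l<k. r l"] \<open>k \<ge> 1\<close> by auto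
    obtain y0 where y0: "y0 \<in> Y" "L y0 \<noteq> 0"
      using nz0 unfolding b_def by (metis (no_types, lifting) mult_zero_right sum.neutral)
    \<comment> \<open>A matrix supported on one column \<open>y0\<close> with \<open>L y0\<close>
      nonzero realizes the function \<open>\<kappa> * b 0 x\<close> after pairing with
      \<open>L\<close>.\<close>
    define B where "B x y = (if y = y0 then \<kappa> * b 0 x / L y0 else 0)" for x y
    have B: "(\<Sum>y\<in>Y. B x y * L y) = \<kappa> * b 0 x" for x
    proof -
      have "(\<Sum>y\<in>Y. B x y * L y) = (\<Sum>y\<in>Y. if y = y0 then \<kappa> * b 0 x else 0)"
        using y0 by (intro sum.cong) (auto simp: B_def)
      then show ?thesis using y0 \<open>finite Y\<close> by simp
    qed
    have "f xs = contract k Y G (\<lambda>l. B (xs ! l))" if "xs \<in> multi_index k X" for xs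
    proof -
      have "f xs = (\<Prod>l<k. r l * b 0 (xs ! l))"
        unfolding b[OF that] using that by (intro prod.cong br) (auto simp: multi_index_def)
      then show ?thesis by (simp add: contract B prod.distrib \<kappa>)
    qed
    then show ?thesis unfolding sym_restricts_def apply_tensor_maps_eq_contract by blast
  qed
qed

lemma tensor_power_rank_one:
  assumes "\<And>ys. ys \<in> multi_index k J \<Longrightarrow> g ys = (\<Prod>l<k. h (ys ! l))"
    and "ys \<in> multi_index k (multi_index n J)"
  shows "tensor_power n g ys = (\<Prod>l<k. \<Prod>m<n. h (ys ! l ! m))"
proof -
  have "g (map (\<lambda>y. y ! m) ys) = (\<Prod>l<k. h (ys ! l ! m))" if "m < n" for m
  proof -
    have "map (\<lambda>y. y ! m) ys \<in> multi_index k J"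
      using assms(2) that by (auto simp: multi_index_def subset_iff)
    then show ?thesis using assms by (simp add: multi_index_def)
  qed
  then show ?thesis by (simp add: tensor_power_def prod.swap[of _ _ "{..<k}"])
qed

section \<open>Uniform overhead and conclusion\<close>

text \<open>The constant \<open>c\<close> is chosen before \<open>N\<close>, \<open>X\<close> and
  \<open>f\<close>, so one overhead serves all powers. It is 0 in the rank-one case and otherwise
  the exponent that produces the monomial.\<close>

lemma restricts_power_imp_sym_restricts:
  fixes g :: "('i, 'a::alg_closed_field) tensor"
  assumes J: "finite J" and k: "k \<ge> 1" and char: "CHAR('a) = 0 \<or> CHAR('a) \<ge> k + 1"
    and g: "symmetric_tensor k J g"
  shows "\<exists>c. \<forall>N (X :: 'x set) f. symmetric_tensor k X f \<longrightarrow>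
    restricts k X f (multi_index N J) (tensor_power N g) \<longrightarrow>
    sym_restricts k X f (multi_index (N + c) J) (tensor_power (N + c) g)"
proof -
  interpret symmetric_form k "\<lambda>vs. contract k J g ((!) vs)"
    by (rule contract_symmetric_form[OF g k char])
  from rank_one_or_simple_degeneration consider
    (rank_one) \<tau> where "\<And>us. length us = k \<Longrightarrow> contract k J g ((!) us) = (\<Prod>u\<leftarrow>us. \<tau> u)"
  | (degeneration) w0 w1 a where "1 \<le> a" "a < k"
      "contract k J g ((!) (replicate a w1 @ replicate (k - a) w0)) \<noteq> 0"
      "\<And>b. b < a \<Longrightarrow> contract k J g ((!) (replicate b w1 @ replicate (k - b) w0)) = 0"
    by blast
  then show ?thesis
  proof cases
    case rank_one
    \<comment> \<open>The values of \<open>\<tau>\<close> at the unit vectors are the coordinates of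
      the linear form whose power is \<open>g\<close>.\<close>
    define h where "h j = \<tau> (\<lambda>i. if i = j then 1 else 0)" for j
    have g_eq: "g ys = (\<Prod>l<k. h (ys ! l))" if ys: "ys \<in> multi_index k J" for ys
    proof -
      have len: "length ys = k" using ys by (simp add: multi_index_def)
      have "g ys = contract k J g ((!) (map (\<lambda>j i. if i = j then 1 else 0) ys))"
        unfolding contract_unit_vectors[OF J ys, symmetric]
        by (rule contract_cong) (auto simp: len)
      also have "\<dots> = (\<Prod>j\<leftarrow>ys. h j)"
        by (subst rank_one) (auto simp: len h_def[abs_def] comp_def)
      also have "\<dots> = (\<Prod>l<k. h (ys ! l))"
        by (simp add: prod.list_conv_set_nth len lessThan_atLeast0)
      finally show ?thesis .
    qed
    have "sym_restricts k X f (multi_index N J) (tensor_power N g)"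
      if "symmetric_tensor k X f" "restricts k X f (multi_index N J) (tensor_power N g)"
      for N and X :: "'x set" and f
    proof (rule sym_restricts_rank_one[OF finite_multi_index[OF J] that(1) k _ that(2)])
      show "tensor_power N g ys = (\<Prod>l<k. \<Prod>m<N. h (ys ! l ! m))"
        if "ys \<in> multi_index k (multi_index N J)" for ys
        using g_eq that by (rule tensor_power_rank_one)
    qed
    then show ?thesis by (intro exI[of _ 0]) simp
  next
    case degeneration
    have "of_nat (fact k) \<noteq> (0::'a)"
      using of_nat_neq_0 by (simp add: fact_prod)
    then show ?thesis
      using power_restricts_to_monomial[OF J g degeneration]
        symmetrize_restriction[OF g _ k] by blast
  qed
qed

theorem theorem3p5:
  fixes k d e :: nat
    and f g :: "(nat, 'a::alg_closed_field) tensor"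
  assumes "k \<ge> 1"
    and "CHAR('a) = 0 \<or> CHAR('a) \<ge> k + 1"
    and "symmetric_tensor k {..<d} f"
    and "symmetric_tensor k {..<e} g"
  shows "asymp_restricts k {..<d} f {..<e} g \<longleftrightarrow> asymp_sym_restricts k {..<d} f {..<e} g"
proof
  assume "asymp_sym_restricts k {..<d} f {..<e} g"
  then show "asymp_restricts k {..<d} f {..<e} g"
    unfolding asymp_sym_restricts_def asymp_restricts_def sym_restricts_def restricts_def by blast
next
  assume "asymp_restricts k {..<d} f {..<e} g"
  then obtain a where a: "(\<lambda>n. real (a n) / real n) \<longlonglongrightarrow> 0"
    and r: "\<And>n. n \<ge> 1 \<Longrightarrow> restricts k (multi_index n {..<d}) (tensor_power n f)
      (multi_index (n + a n) {..<e}) (tensor_power (n + a n) g)"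
    unfolding asymp_restricts_def by blast
  obtain c where c: "\<And>N (X :: nat list set) f. symmetric_tensor k X f \<Longrightarrow>
      restricts k X f (multi_index N {..<e}) (tensor_power N g) \<Longrightarrow>
      sym_restricts k X f (multi_index (N + c) {..<e}) (tensor_power (N + c) g)"
    using restricts_power_imp_sym_restricts[OF finite_lessThan assms(1,2,4)] by blast
  \<comment> \<open>The constant overhead is absorbed by the sublinear term.\<close>
  have "(\<lambda>n. real (a n) / real n + real c / real n) \<longlonglongrightarrow> 0 + 0"
    using a by (intro tendsto_add lim_const_over_n)
  then have "(\<lambda>n. real (a n + c) / real n) \<longlonglongrightarrow> 0"
    by (simp add: add_divide_distrib)
  moreover have "sym_restricts k (multi_index n {..<d}) (tensor_power n f)
      (multi_index (n + (a n + c)) {..<e}) (tensor_power (n + (a n + c)) g)" if "n \<ge> 1" for n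
    using c[OF tensor_power_symmetric[OF assms(3)] r[OF that]] by (simp add: add.assoc)
  ultimately show "asymp_sym_restricts k {..<d} f {..<e} g"
    unfolding asymp_sym_restricts_def by (intro exI[of _ "\<lambda>n. a n + c"]) simp
qed

end
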